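(* Let $\alpha,\beta\in(0,1)$. There is no function $$\mathcal F:[0,\infty)^4\longrightarrow[0,\infty)$$ that is bounded on bounded subsets and for which $$[D_p^2f]_{C_p^\alpha(\mathcal Q_{1/2})}\le\mathcal F\Bigl(\|f\|_{L^\infty(\mathcal Q_1)},\ \|s\|_{C_p^\beta(\mathcal Q_1)},\ \|A\|_{C_p^\beta(B_1)},\ \|B\|_{C_p^\beta(B_1)}\Bigr)$$ holds for every smooth solution of $$\partial_t f+\frac{p}{\langle p\rangle}\cdot\nabla_xf=\operatorname{tr}\bigl(A(p)D_p^2f\bigr)+B(p)\cdot\nabla_pf+s$$ on $\mathcal Q_1$, even when the coefficients are restricted to a fixed uniformly elliptic class, i.e. to $A$ satisfying $\lambda\,\mathrm{Id}\le A(p)\le\Lambda\,\mathrm{Id}$ on $B_1$ for certain fixed constants $0<\lambda\le\Lambda<\infty$.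
   Context: Variables: $t\in\mathbb R$, $x\in\mathbb R^3$, $p\in\mathbb R^3$; $\langle p\rangle=(1+|p|^2)^{1/2}$. The coefficients $A=A(p)$ (symmetric $3\times3$ matrix-valued) and $B=B(p)$ ($\mathbb R^3$-valued) depend on $p$ only and are smooth; the forcing $s=s(t,x,p)$ is smooth. Cylinders: for $r>0$, $\mathcal Q_r=(-r^2,0]\times B_{r^3}^x\times B_r^p$, where $B^x_\rho,B^p_\rho$ are the balls of radius $\rho$ centered at $0$ in $x$ and $p$; $B_1$ is the unit momentum ball. Momentum H\"older seminorm and norm: for $h=h(t,x,p)$ on a product cylinder $Q$ and $\gamma\in(0,1)$, $$[h]_{C_p^\gamma(Q)}=\sup_{\substack{(t,x,p),(t,x,p')\in Q\\0<|p-p'|<1/2}}\frac{|h(t,x,p)-h(t,x,p')|}{|p-p'|^\gamma},\qquad \|h\|_{C_p^\gamma(Q)}=\|h\|_{L^\infty(Q)}+[h]_{C_p^\gamma(Q)}.$$ For functions of $p$ alone the same definitions are used on a momentum ball. Matrix-valued functions are measured in the Frobenius norm. *)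

theory Defs
  imports "HOL-Analysis.Analysis" "HOL-Probability.Essential_Supremum"
begin

text \<open>A point of phase space is a triple \<open>(t, x, p)\<close> of time, position and momentum.\<close>

type_synonym phase = "real \<times> (real^3) \<times> (real^3)"

definition cyl :: "real \<Rightarrow> phase set" where
  "cyl r = {-(r^2)<..0} \<times> ball 0 (r^3) \<times> ball 0 r"

definition jbracket :: "real^3 \<Rightarrow> real" where
  "jbracket p = sqrt (1 + (norm p)^2)"

text \<open>\<open>ck_on k g U\<close> is meant for open \<open>U\<close>: all iterated directional derivatives of \<open>g\<close> of
  order below \<open>k\<close> are differentiable on \<open>U\<close>, and those of order \<open>k\<close> are continuous.\<close>

fun ck_on :: "nat \<Rightarrow> ('a::euclidean_space \<Rightarrow> 'b::real_normed_vector) \<Rightarrow> 'a set \<Rightarrow> bool" where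
  "ck_on 0 g U \<longleftrightarrow> continuous_on U g"
| "ck_on (Suc k) g U \<longleftrightarrow>
     (\<forall>z\<in>U. g differentiable (at z)) \<and>
     (\<forall>v. ck_on k (\<lambda>z. frechet_derivative g (at z) v) U)"

text \<open>On a set that need not be open, such as a cylinder with its final time included, smoothness
  means smoothness on an open neighbourhood of the set. Functions here are total, so this replaces
  the usual requirement that the restriction to the set have a smooth extension. It makes the
  two-sided derivatives at \<open>t = 0\<close> below agree with the one-sided derivatives from within the
  cylinder.\<close>

definition smooth_on :: "('a::euclidean_space \<Rightarrow> 'b::real_normed_vector) \<Rightarrow> 'a set \<Rightarrow> bool" where
  "smooth_on g S \<longleftrightarrow> (\<exists>U. open U \<and> S \<subseteq> U \<and> (\<forall>k. ck_on k g U))"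

text \<open>Norms and seminorms are valued in \<^typ>\<open>ennreal\<close>, so that no finiteness is presupposed.
  For values in \<^typ>\<open>real^3^3\<close>, \<^const>\<open>norm\<close> is the Frobenius norm.\<close>

definition linf_norm ::
    "'a::euclidean_space set \<Rightarrow> ('a \<Rightarrow> 'b::real_normed_vector) \<Rightarrow> ennreal" where
  "linf_norm S g = esssup (lebesgue_on S) (\<lambda>z. ennreal (norm (g z)))"

definition holder_seminorm_p ::
    "real \<Rightarrow> phase set \<Rightarrow> (phase \<Rightarrow> 'b::real_normed_vector) \<Rightarrow> ennreal" where
  "holder_seminorm_p \<gamma> Q h =
     (SUP (t, x, p, p') \<in> {(t, x, p, p'). (t, x, p) \<in> Q \<and> (t, x, p') \<in> Q \<and>
                                          0 < norm (p - p') \<and> norm (p - p') < 1/2}.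
        ennreal (norm (h (t, x, p) - h (t, x, p')) / norm (p - p') powr \<gamma>))"

definition holder_norm_p ::
    "real \<Rightarrow> phase set \<Rightarrow> (phase \<Rightarrow> 'b::real_normed_vector) \<Rightarrow> ennreal" where
  "holder_norm_p \<gamma> Q h = linf_norm Q h + holder_seminorm_p \<gamma> Q h"

definition holder_seminorm ::
    "real \<Rightarrow> (real^3) set \<Rightarrow> (real^3 \<Rightarrow> 'b::real_normed_vector) \<Rightarrow> ennreal" where
  "holder_seminorm \<gamma> S g =
     (SUP (p, p') \<in> {(p, p'). p \<in> S \<and> p' \<in> S \<and> 0 < norm (p - p') \<and> norm (p - p') < 1/2}.
        ennreal (norm (g p - g p') / norm (p - p') powr \<gamma>))"

definition holder_norm ::
    "real \<Rightarrow> (real^3) set \<Rightarrow> (real^3 \<Rightarrow> 'b::real_normed_vector) \<Rightarrow> ennreal" where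
  "holder_norm \<gamma> S g = linf_norm S g + holder_seminorm \<gamma> S g"

definition gradient :: "(real^3 \<Rightarrow> real) \<Rightarrow> real^3 \<Rightarrow> real^3" where
  "gradient g q = (\<chi> i. frechet_derivative g (at q) (axis i 1))"

definition dt :: "(phase \<Rightarrow> real) \<Rightarrow> phase \<Rightarrow> real" where
  "dt f = (\<lambda>(t, x, p). deriv (\<lambda>\<tau>. f (\<tau>, x, p)) t)"

definition grad_x :: "(phase \<Rightarrow> real) \<Rightarrow> phase \<Rightarrow> real^3" where
  "grad_x f = (\<lambda>(t, x, p). gradient (\<lambda>y. f (t, y, p)) x)"

definition grad_p :: "(phase \<Rightarrow> real) \<Rightarrow> phase \<Rightarrow> real^3" where
  "grad_p f = (\<lambda>(t, x, p). gradient (\<lambda>q. f (t, x, q)) p)"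

definition hess_p :: "(phase \<Rightarrow> real) \<Rightarrow> phase \<Rightarrow> real^3^3" where
  "hess_p f = (\<lambda>(t, x, p). jacobian (gradient (\<lambda>q. f (t, x, q))) (at p))"

definition smooth_solution ::
    "phase set \<Rightarrow> (real^3 \<Rightarrow> real^3^3) \<Rightarrow> (real^3 \<Rightarrow> real^3) \<Rightarrow> (phase \<Rightarrow> real) \<Rightarrow> (phase \<Rightarrow> real) \<Rightarrow> bool"
  where
  "smooth_solution Q A B s f \<longleftrightarrow>
     smooth_on A UNIV \<and> (\<forall>p. transpose (A p) = A p) \<and> smooth_on B UNIV \<and> smooth_on s UNIV \<and>
     smooth_on f Q \<and>
     (\<forall>(t, x, p)\<in>Q.
        dt f (t, x, p) + ((1 / jbracket p) *\<^sub>R p) \<bullet> grad_x f (t, x, p)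
          = trace (A p ** hess_p f (t, x, p)) + B p \<bullet> grad_p f (t, x, p) + s (t, x, p))"

definition elliptic_on :: "real \<Rightarrow> real \<Rightarrow> (real^3) set \<Rightarrow> (real^3 \<Rightarrow> real^3^3) \<Rightarrow> bool" where
  "elliptic_on lam Lam S A \<longleftrightarrow>
     (\<forall>p\<in>S. \<forall>\<xi>. lam * (\<xi> \<bullet> \<xi>) \<le> \<xi> \<bullet> (A p *v \<xi>) \<and> \<xi> \<bullet> (A p *v \<xi>) \<le> Lam * (\<xi> \<bullet> \<xi>))"

definition nonneg_quadruples :: "(real \<times> real \<times> real \<times> real) set" where
  "nonneg_quadruples = {0..} \<times> {0..} \<times> {0..} \<times> {0..}"

definition bounding_function :: "(real \<times> real \<times> real \<times> real \<Rightarrow> real) \<Rightarrow> bool" where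
  "bounding_function F \<longleftrightarrow>
     F \<in> nonneg_quadruples \<rightarrow> {0..} \<and>
     (\<forall>S\<subseteq>nonneg_quadruples. bounded S \<longrightarrow> bounded (F ` S))"

end

theory Submission
  imports Defs
begin

text \<open>
  The estimate fails already for the fixed coefficients \<open>A(p) = \<langle>p\<rangle>\<^sup>-\<^sup>1 Id\<close> and \<open>B = 0\<close>. With this
  choice, the equation for functions that do not depend on time becomes, after multiplication by
  \<open>\<langle>p\<rangle>\<close>, the Kolmogorov equation
  \<open>p \<cdot> \<nabla>\<^sub>x f = \<Delta>\<^sub>p f + \<langle>p\<rangle> s\<close>, whose velocity is \<open>p\<close> itself, so one may look for \<open>f\<close> as a function of
  the two scalars \<open>x\<^sub>1\<close> and \<open>p\<^sub>1\<close> only.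

  The norm of \<open>s\<close> in the estimate sees no regularity in \<open>x\<close>, so the forcing may oscillate at
  frequency \<open>m\<^sup>3\<close> in \<open>x\<^sub>1\<close>. The kinetic scaling \<open>(x, p) \<mapsto> (m\<^sup>3 x, m p)\<close> then transfers this
  oscillation to the momentum variable at scale \<open>1/m\<close>, while leaving second momentum derivatives of
  \<open>m\<^sup>-\<^sup>2 K(m\<^sup>3 x\<^sub>1, m p\<^sub>1)\<close> of order one. Here \<open>K\<close> should solve \<open>w K\<^sub>\<theta> = K\<^sub>w\<^sub>w + cos \<theta>\<close> with
  \<open>K\<^sub>w\<^sub>w\<close> not constant in \<open>w\<close>. Superposing the damped travelling waves
  \<open>cos (\<theta> - w \<sigma>) exp (-\<sigma>\<^sup>3/3)\<close>, on which \<open>w \<partial>\<^sub>\<theta> - \<partial>\<^sub>w\<^sup>2\<close> acts as \<open>-\<partial>\<^sub>\<sigma>\<close>, over \<open>0 \<le> \<sigma> \<le> T\<close> gives such a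
  \<open>K\<close> up to the boundary term at \<open>\<sigma> = T\<close> (lemma \<open>osc_moment_ode\<close>). For \<open>T = m\<close> that term carries
  the factor \<open>exp (-m\<^sup>3/3)\<close>, which outweighs the Lipschitz constant \<open>m\<^sup>2\<close> of its oscillation in \<open>p\<close>.

  Therefore \<open>f\<close> and the \<open>p\<close>-Hoelder norm of \<open>s\<close> stay bounded as \<open>m\<close> grows (\<open>wave_bound\<close>,
  \<open>holder_norm_p_wave_forcing\<close>), whereas \<open>D\<^sub>p\<^sup>2 f\<close> changes by at least \<open>1/12\<close> between \<open>p = 0\<close> and
  \<open>p = (\<pi>/m) e\<^sub>1\<close> (\<open>osc_moment_gap\<close>). Its \<open>\<alpha>\<close>-seminorm is thus at least of order \<open>m\<^sup>\<alpha>\<close>, while the four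
  arguments of the supposed bounding function remain in a bounded set.
\<close>

section \<open>Closure properties of smooth functions\<close>

lemma ck_on_SucI:
  assumes "\<And>z. (g has_derivative g' z) (at z)" and "\<And>v. ck_on k (\<lambda>z. g' z v) UNIV"
  shows "ck_on (Suc k) g UNIV"
proof -
  have "frechet_derivative g (at z) = g' z" for z
    using frechet_derivative_at[OF assms(1)[of z]] by simp
  then show ?thesis
    using assms by (auto simp: differentiable_def)
qed

lemma ck_on_Suc_has_derivative:
  "ck_on (Suc k) g UNIV \<Longrightarrow> (g has_derivative frechet_derivative g (at z)) (at z)"
  by (simp add: frechet_derivative_works[symmetric])

lemma ck_on_SucD: "ck_on (Suc k) g U \<Longrightarrow> ck_on k g U"
proof (induction k arbitrary: g)
  case 0
  then show ?case
    by (auto intro!: continuous_at_imp_continuous_on differentiable_imp_continuous_within)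
next
  case (Suc k)
  show ?case
    unfolding ck_on.simps(2)[of k] using Suc.IH Suc.prems by (metis ck_on.simps(2))
qed

lemma smooth_onI: "(\<And>k. ck_on k g UNIV) \<Longrightarrow> smooth_on g S"
  unfolding smooth_on_def by (intro exI[where x=UNIV]) simp

lemma ck_on_const: "ck_on k (\<lambda>z. c) UNIV"
proof (induction k arbitrary: c)
  case (Suc k)
  show ?case by (rule ck_on_SucI[where g'="\<lambda>z v. 0"]) (auto intro: Suc.IH)
qed auto

lemma ck_on_bounded_linear:
  assumes "bounded_linear L"
  shows "ck_on k L UNIV"
proof (cases k)
  case 0
  then show ?thesis using assms by (simp add: linear_continuous_on)
next
  case (Suc j)
  show ?thesis unfolding Suc
    by (rule ck_on_SucI[where g'="\<lambda>z. L"])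
       (auto intro: assms bounded_linear_imp_has_derivative ck_on_const)
qed

lemma ck_on_add:
  assumes "ck_on k f UNIV" "ck_on k g UNIV"
  shows "ck_on k (\<lambda>z. f z + g z) UNIV"
  using assms
proof (induction k arbitrary: f g)
  case 0
  then show ?case by (auto intro: continuous_intros)
next
  case (Suc k)
  show ?case
    by (rule ck_on_SucI[OF has_derivative_add[OF ck_on_Suc_has_derivative[OF Suc.prems(1)]
          ck_on_Suc_has_derivative[OF Suc.prems(2)]]])
       (use Suc in auto)
qed

lemma ck_on_scaleR:
  fixes f :: "'a::euclidean_space \<Rightarrow> real"
  assumes "ck_on k f UNIV" "ck_on k g UNIV"
  shows "ck_on k (\<lambda>z. f z *\<^sub>R g z) UNIV"
  using assms
proof (induction k arbitrary: f g)
  case 0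
  then show ?case by (auto intro: continuous_intros)
next
  case (Suc k)
  show ?case
    by (rule ck_on_SucI[OF has_derivative_scaleR[OF ck_on_Suc_has_derivative[OF Suc.prems(1)]
          ck_on_Suc_has_derivative[OF Suc.prems(2)]]])
       (use Suc ck_on_SucD[OF Suc.prems(1)] ck_on_SucD[OF Suc.prems(2)]
         in \<open>auto intro!: ck_on_add\<close>)
qed

lemmas ck_on_mult = ck_on_scaleR[where 'b=real, unfolded real_scaleR_def]

lemma ck_on_diff:
  fixes f g :: "'a::euclidean_space \<Rightarrow> real"
  assumes "ck_on k f UNIV" "ck_on k g UNIV"
  shows "ck_on k (\<lambda>z. f z - g z) UNIV"
  using ck_on_add[OF assms(1) ck_on_mult[OF ck_on_const[of k "-1"] assms(2)]] by simp

text \<open>Smoothness of an outer function is expressed by membership in a family closed under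
  differentiation: by the chain rule, differentiating \<open>\<phi> \<circ> g\<close> only replaces \<open>\<phi>\<close> by another member and
  multiplies by a derivative of \<open>g\<close>, so an induction on the order closes. The set \<open>D\<close> accommodates
  powers, which are smooth only on the positive half-line.\<close>

lemma ck_on_compose_family:
  fixes g :: "'a::euclidean_space \<Rightarrow> real" and \<Phi> :: "(real \<Rightarrow> real) set"
  assumes family: "\<And>\<phi>. \<phi> \<in> \<Phi> \<Longrightarrow> \<exists>\<phi>'\<in>\<Phi>. \<forall>r\<in>D. (\<phi> has_real_derivative \<phi>' r) (at r)"
    and D: "\<And>z. g z \<in> D" and g: "\<And>k. ck_on k g UNIV" and \<phi>: "\<phi> \<in> \<Phi>"
  shows "ck_on k (\<lambda>z. \<phi> (g z)) UNIV"
  using \<phi>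
proof (induction k arbitrary: \<phi>)
  case 0
  obtain \<phi>' where d: "\<And>r. r \<in> D \<Longrightarrow> (\<phi> has_real_derivative \<phi>' r) (at r)"
    using family[OF 0] by blast
  have "continuous_on D \<phi>"
    using d by (auto intro!: continuous_at_imp_continuous_on DERIV_isCont)
  moreover have "continuous_on UNIV g"
    using g[of 0] by simp
  ultimately show ?case
    using D by (auto intro: continuous_on_compose2)
next
  case (Suc k)
  obtain \<phi>' where \<phi>': "\<phi>' \<in> \<Phi>" "\<And>r. r \<in> D \<Longrightarrow> (\<phi> has_real_derivative \<phi>' r) (at r)"
    using family[OF Suc.prems] by blast
  have *: "((\<lambda>z. \<phi> (g z)) has_derivative (\<lambda>v. \<phi>' (g z) * frechet_derivative g (at z) v)) (at z)" for z
    using has_derivative_compose[OF ck_on_Suc_has_derivative[OF g[of 1, unfolded One_nat_def]]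
        \<phi>'(2)[OF D, unfolded has_field_derivative_def]] .
  show ?case
    by (rule ck_on_SucI[OF *])
       (use Suc.IH[OF \<phi>'(1)] g[of "Suc k"] in \<open>auto intro!: ck_on_mult\<close>)
qed

lemma ck_on_cos:
  fixes g :: "'a::euclidean_space \<Rightarrow> real"
  assumes "\<And>k. ck_on k g UNIV"
  shows "ck_on k (\<lambda>z. cos (g z)) UNIV"
proof -
  have "\<exists>\<phi>'\<in>range (\<lambda>\<theta> r. cos (r + \<theta>)). \<forall>r\<in>UNIV. (\<phi> has_real_derivative \<phi>' r) (at r)"
    if "\<phi> \<in> range (\<lambda>\<theta> r. cos (r + \<theta>))" for \<phi>
  proof -
    from that obtain \<theta> where \<theta>: "\<phi> = (\<lambda>r. cos (r + \<theta>))" by auto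
    have "(\<phi> has_real_derivative cos (r + (\<theta> + pi/2))) (at r)" for r
      unfolding \<theta> by (auto intro!: derivative_eq_intros simp: cos_add sin_add algebra_simps)
    then show ?thesis
      by (intro bexI[where x="\<lambda>r. cos (r + (\<theta> + pi/2))"]) auto
  qed
  moreover have "(\<lambda>r. cos (r + 0)) \<in> range (\<lambda>\<theta> r. cos (r + \<theta> :: real))" by blast
  ultimately show ?thesis
    using ck_on_compose_family[of "range (\<lambda>\<theta> r. cos (r + \<theta>))" UNIV g "\<lambda>r. cos (r + 0)"] assms
    by simp
qed

lemma ck_on_sin:
  fixes g :: "'a::euclidean_space \<Rightarrow> real"
  assumes "\<And>k. ck_on k g UNIV"
  shows "ck_on k (\<lambda>z. sin (g z)) UNIV"
proof -
  have "ck_on k (\<lambda>z. cos (g z + - (pi/2))) UNIV"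
    by (intro ck_on_cos ck_on_add ck_on_const assms)
  then show ?thesis by (simp add: cos_diff)
qed

lemma ck_on_powr:
  fixes g :: "'a::euclidean_space \<Rightarrow> real"
  assumes "\<And>k. ck_on k g UNIV" "\<And>z. 0 < g z"
  shows "ck_on k (\<lambda>z. g z powr a) UNIV"
proof -
  define \<Phi> :: "(real \<Rightarrow> real) set" where "\<Phi> = {\<lambda>r. c * r powr b |c b. True}"
  have "\<exists>\<phi>'\<in>\<Phi>. \<forall>r\<in>{0<..}. (\<phi> has_real_derivative \<phi>' r) (at r)"
    if "\<phi> \<in> \<Phi>" for \<phi>
  proof -
    from that obtain c b where cb: "\<phi> = (\<lambda>r. c * r powr b)" by (auto simp: \<Phi>_def)
    have "(\<phi> has_real_derivative (c * b) * r powr (b - 1)) (at r)" if "r > 0" for r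
      unfolding cb using that by (auto intro!: derivative_eq_intros)
    then show ?thesis
      by (intro bexI[where x="\<lambda>r. (c * b) * r powr (b - 1)"]) (auto simp: \<Phi>_def)
  qed
  moreover have "(\<lambda>r::real. 1 * r powr a) \<in> \<Phi>" unfolding \<Phi>_def by blast
  ultimately show ?thesis
    using ck_on_compose_family[of \<Phi> "{0<..}" g "\<lambda>r. 1 * r powr a"] assms by simp
qed

lemma jbracket_pos: "0 < jbracket p"
  by (simp add: jbracket_def add_pos_nonneg)

lemma jbracket_ge_1: "1 \<le> jbracket p"
  by (simp add: jbracket_def)

text \<open>Composition with a linear map \<open>P\<close> covers both functions of momentum alone (\<open>P\<close> the identity) and
  functions on phase space (\<open>P\<close> the projection to momentum).\<close>

lemma ck_on_inverse_jbracket: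
  assumes "bounded_linear P"
  shows "ck_on k (\<lambda>z. 1 / jbracket (P z)) UNIV"
proof -
  have bl: "bounded_linear (\<lambda>z. P z $ i)" for i
    using bounded_linear_compose[OF bounded_linear_vec_nth assms] .
  have eq: "1 / jbracket p = (1 + (p$1 * p$1 + (p$2 * p$2 + p$3 * p$3))) powr (-1/2)" for p
  proof -
    have "(norm p)^2 = p$1 * p$1 + (p$2 * p$2 + p$3 * p$3)"
      by (simp add: power2_norm_eq_inner inner_vec_def sum_3)
    then show ?thesis
      by (simp add: jbracket_def powr_minus powr_half_sqrt add_nonneg_nonneg divide_simps)
  qed
  show ?thesis unfolding eq
    by (intro ck_on_powr ck_on_add ck_on_mult ck_on_const ck_on_bounded_linear bl)
       (auto intro: add_pos_nonneg)
qed

section \<open>The damped oscillatory moments\<close>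

text \<open>For \<open>n = 0\<close> and \<open>T = \<infinity>\<close> this would be the real part of \<open>e\<^sup>i\<^sup>\<theta> \<pi> Hi(-i w)\<close> with
  the Scorer function \<open>Hi\<close>. A finite \<open>T\<close> makes differentiation under the integral immediate and costs only a boundary term. The weights \<open>\<sigma>\<^sup>n\<close> and the shift \<open>\<theta>\<close> make the family
  closed under differentiation in \<open>w\<close>.\<close>

definition osc_moment :: "real \<Rightarrow> nat \<Rightarrow> real \<Rightarrow> real \<Rightarrow> real" where
  "osc_moment T n \<theta> w = integral {0..T} (\<lambda>\<sigma>. \<sigma>^n * cos (\<theta> - w * \<sigma>) * exp (- (\<sigma>^3) / 3))"

lemma osc_moment_integrable:
  "(\<lambda>\<sigma>. \<sigma>^n * cos (\<theta> - w * \<sigma>) * exp (- (\<sigma>^3) / 3)) integrable_on {a..b::real}"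
  by (intro integrable_continuous_interval continuous_intros) auto

lemma osc_moment_DERIV:
  "(osc_moment T n \<theta> has_real_derivative osc_moment T (Suc n) (\<theta> - pi/2) w) (at w)"
proof -
  have "((\<lambda>w. integral (cbox 0 T) (\<lambda>\<sigma>. \<sigma>^n * cos (\<theta> - w * \<sigma>) * exp (- (\<sigma>^3) / 3)))
      has_real_derivative
      integral (cbox 0 T) (\<lambda>\<sigma>. \<sigma>^(Suc n) * cos (\<theta> - pi/2 - w * \<sigma>) * exp (- (\<sigma>^3) / 3)))
      (at w within UNIV)"
  proof (rule leibniz_rule_field_derivative[where U=UNIV and
        fx="\<lambda>w \<sigma>. \<sigma>^(Suc n) * cos (\<theta> - pi/2 - w * \<sigma>) * exp (- (\<sigma>^3) / 3)"])
    fix w \<sigma> :: real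
    have "cos (\<theta> - pi/2 - w * \<sigma>) = sin (\<theta> - w * \<sigma>)"
      using cos_diff[of "\<theta> - w * \<sigma>" "pi/2"] by (simp add: algebra_simps)
    then show "((\<lambda>w. \<sigma>^n * cos (\<theta> - w * \<sigma>) * exp (- (\<sigma>^3) / 3)) has_real_derivative
        \<sigma>^(Suc n) * cos (\<theta> - pi/2 - w * \<sigma>) * exp (- (\<sigma>^3) / 3)) (at w within UNIV)"
      by (auto intro!: derivative_eq_intros)
  next
    show "(\<lambda>\<sigma>. \<sigma>^n * cos (\<theta> - w * \<sigma>) * exp (- (\<sigma>^3) / 3)) integrable_on cbox 0 T" for w
      unfolding cbox_interval by (rule osc_moment_integrable)
  qed (auto simp: case_prod_unfold intro!: continuous_intros)
  then show ?thesis by (simp add: osc_moment_def[abs_def])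
qed

text \<open>Separating the variables reduces all questions on regularity in \<open>(\<theta>, w)\<close> jointly to
  questions on functions of one real variable.\<close>

lemma osc_moment_phase:
  "osc_moment T n \<theta> w = cos \<theta> * osc_moment T n 0 w + sin \<theta> * osc_moment T n (pi/2) w"
proof -
  note i = integrable_on_mult_right[OF osc_moment_integrable]
  have "cos \<theta> * osc_moment T n 0 w + sin \<theta> * osc_moment T n (pi/2) w =
     integral {0..T} (\<lambda>\<sigma>. cos \<theta> * (\<sigma>^n * cos (0 - w * \<sigma>) * exp (- (\<sigma>^3) / 3))
       + sin \<theta> * (\<sigma>^n * cos (pi/2 - w * \<sigma>) * exp (- (\<sigma>^3) / 3)))"
    unfolding osc_moment_def by (simp only: integral_add[OF i i] integral_mult_right)
  also have "\<dots> = osc_moment T n \<theta> w"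
    unfolding osc_moment_def
    by (rule arg_cong[where f="integral {0..T}"]) (simp add: fun_eq_iff cos_diff algebra_simps)
  finally show ?thesis by simp
qed

lemma osc_moment_DERIV_phase:
  "((\<lambda>\<theta>. osc_moment T n \<theta> w) has_real_derivative osc_moment T n (\<theta> + pi/2) w) (at \<theta>)"
proof -
  have "((\<lambda>\<theta>. cos \<theta> * osc_moment T n 0 w + sin \<theta> * osc_moment T n (pi/2) w) has_real_derivative
      osc_moment T n (\<theta> + pi/2) w) (at \<theta>)"
    unfolding osc_moment_phase[of T n "\<theta> + pi/2"]
    by (auto intro!: derivative_eq_intros simp: cos_add sin_add)
  then show ?thesis by (subst osc_moment_phase[abs_def])
qed

text \<open>Under the integral sign, \<open>w \<partial>\<^sub>\<theta> - \<partial>\<^sub>w\<^sup>2\<close> turns \<open>cos (\<theta> - w \<sigma>) exp (-\<sigma>\<^sup>3/3)\<close> into the negative of its own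
  \<open>\<sigma>\<close>-derivative, so only the two boundary values survive. The shifts by \<open>\<pi>/2\<close> and \<open>-\<pi>\<close> encode
  \<open>\<partial>\<^sub>\<theta>\<close> and \<open>\<partial>\<^sub>w\<^sup>2\<close>.\<close>

lemma osc_moment_ode:
  assumes "0 \<le> T"
  shows "w * osc_moment T 0 (\<theta> + pi/2) w
    = osc_moment T 2 (\<theta> - pi) w + (cos \<theta> - cos (\<theta> - w * T) * exp (- (T^3) / 3))"
proof -
  let ?e = "\<lambda>\<sigma>::real. exp (- (\<sigma>^3) / 3)"
  note i = osc_moment_integrable
  have "((\<lambda>\<sigma>. w * (\<sigma>^0 * cos (\<theta> + pi/2 - w * \<sigma>) * ?e \<sigma>)
          - \<sigma>^2 * cos (\<theta> - pi - w * \<sigma>) * ?e \<sigma>) has_integral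
     (- (cos (\<theta> - w * T) * ?e T)) - (- (cos (\<theta> - w * 0) * ?e 0))) {0..T}"
  proof (rule fundamental_theorem_of_calculus[OF assms])
    fix \<sigma> :: real
    have "cos (\<theta> + pi/2 - w * \<sigma>) = - sin (\<theta> - w * \<sigma>)"
      using cos_add[of "\<theta> - w * \<sigma>" "pi/2"] by (simp add: algebra_simps)
    moreover have "cos (\<theta> - pi - w * \<sigma>) = - cos (\<theta> - w * \<sigma>)"
      using cos_diff[of "\<theta> - w * \<sigma>" "pi"] by (simp add: algebra_simps)
    ultimately show "((\<lambda>\<sigma>. - (cos (\<theta> - w * \<sigma>) * ?e \<sigma>)) has_vector_derivative
        w * (\<sigma>^0 * cos (\<theta> + pi/2 - w * \<sigma>) * ?e \<sigma>)
          - \<sigma>^2 * cos (\<theta> - pi - w * \<sigma>) * ?e \<sigma>) (at \<sigma> within {0..T})"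
      by (auto intro!: derivative_eq_intros
          simp: has_real_derivative_iff_has_vector_derivative[symmetric])
  qed
  from integral_unique[OF this]
  have "w * osc_moment T 0 (\<theta> + pi/2) w - osc_moment T 2 (\<theta> - pi) w
      = cos \<theta> - cos (\<theta> - w * T) * ?e T"
    unfolding osc_moment_def
    by (subst (asm) integral_diff[OF integrable_on_mult_right[OF i] i]) simp
  then show ?thesis by simp
qed

lemma osc_moment_bound:
  assumes "0 \<le> T"
  shows "\<bar>osc_moment T 0 \<theta> w\<bar> \<le> T"
proof -
  have "norm (osc_moment T 0 \<theta> w) \<le> integral {0..T} (\<lambda>\<sigma>. 1)"
    unfolding osc_moment_def
  proof (rule integral_norm_bound_integral[OF osc_moment_integrable])
    fix \<sigma> :: real assume \<sigma>: "\<sigma> \<in> {0..T}"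
    then have "exp (- (\<sigma>^3) / 3) \<le> 1" by simp
    then show "norm (\<sigma>^0 * cos (\<theta> - w * \<sigma>) * exp (- (\<sigma>^3) / 3)) \<le> 1"
      by (simp add: abs_mult mult_le_one)
  qed auto
  then show ?thesis using assms by simp
qed

text \<open>The second \<open>w\<close>-derivative of the zeroth moment, at phase \<open>\<theta> = 0\<close>, oscillates by an amount
  independent of \<open>T \<ge> 1\<close>: the difference is the integral of \<open>\<sigma>\<^sup>2 (1 - cos (\<pi> \<sigma>)) exp (-\<sigma>\<^sup>3/3) \<ge> 0\<close>, to which
  the interval \<open>[1/2, 1]\<close>, where the cosine is nonpositive, contributes a fixed amount.\<close>

lemma osc_moment_gap:
  assumes "1 \<le> T"
  shows "1/12 \<le> osc_moment T 2 (- pi) pi - osc_moment T 2 (- pi) 0"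
proof -
  define h where "h \<sigma> = \<sigma>^2 * cos (- pi - pi * \<sigma>) * exp (- (\<sigma>^3) / 3)
      - \<sigma>^2 * cos (- pi - 0 * \<sigma>) * exp (- (\<sigma>^3) / 3)" for \<sigma> :: real
  have h: "h \<sigma> = \<sigma>^2 * (1 - cos (pi * \<sigma>)) * exp (- (\<sigma>^3) / 3)" for \<sigma>
    by (simp add: h_def cos_diff algebra_simps)
  have int: "h integrable_on {a..b}" for a b
    unfolding h_def by (intro integrable_diff osc_moment_integrable)
  have "integral {1/2..1::real} (\<lambda>\<sigma>. 1/6 :: real) \<le> integral {1/2..1} h"
  proof (rule integral_le[OF _ int])
    fix \<sigma> :: real assume \<sigma>: "\<sigma> \<in> {1/2..1}"
    have "cos (pi * \<sigma>) \<le> cos (pi / 2)"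
      using \<sigma> by (subst cos_mono_le_eq) auto
    then have c: "1 \<le> 1 - cos (pi * \<sigma>)" by simp
    have "(1/2)^2 \<le> \<sigma>^2"
      using \<sigma> by (intro power_mono) auto
    then have s: "1/4 \<le> \<sigma>^2" by (simp add: power2_eq_square)
    have "\<sigma>^3 \<le> 1" using \<sigma> by (simp add: power_le_one)
    then have e: "2/3 \<le> exp (- (\<sigma>^3) / 3)"
      using exp_ge_add_one_self[of "- (\<sigma>^3) / 3"] by linarith
    have "1/4 * 1 * (2/3) \<le> h \<sigma>"
      unfolding h using c s e by (intro mult_mono) auto
    then show "1/6 \<le> h \<sigma>" by simp
  qed auto
  also have "\<dots> \<le> integral {0..T} h"
    using assms by (intro integral_subset_le int) (auto simp: h)
  also have "\<dots> = osc_moment T 2 (- pi) pi - osc_moment T 2 (- pi) 0"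
    unfolding osc_moment_def h_def[abs_def] by (intro integral_diff osc_moment_integrable)
  finally show ?thesis by simp
qed

lemma ck_on_osc_moment:
  assumes "\<And>k. ck_on k g UNIV"
  shows "ck_on k (\<lambda>z. osc_moment T n \<theta> (g z)) UNIV"
proof -
  define \<Phi> where "\<Phi> = {osc_moment T n \<theta> |n \<theta>. True}"
  have "\<exists>\<phi>'\<in>\<Phi>. \<forall>r\<in>UNIV. (\<phi> has_real_derivative \<phi>' r) (at r)" if "\<phi> \<in> \<Phi>" for \<phi>
  proof -
    from that obtain n \<theta> where \<phi>: "\<phi> = osc_moment T n \<theta>" by (auto simp: \<Phi>_def)
    show ?thesis
      unfolding \<phi> using osc_moment_DERIV
      by (intro bexI[where x="osc_moment T (Suc n) (\<theta> - pi/2)"]) (auto simp: \<Phi>_def)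
  qed
  moreover have "osc_moment T n \<theta> \<in> \<Phi>" unfolding \<Phi>_def by blast
  ultimately show ?thesis
    using ck_on_compose_family[of \<Phi> UNIV g "osc_moment T n \<theta>"] assms by simp
qed

section \<open>Derivatives of functions of one coordinate\<close>

lemma gradient_coordinate:
  assumes "(\<phi> has_real_derivative d) (at (q $ 1))"
  shows "gradient (\<lambda>q. \<phi> (q $ 1)) q = axis 1 d"
proof -
  have "((\<lambda>q. \<phi> (q $ 1)) has_derivative (\<lambda>v. d * v $ 1)) (at q)"
    using has_derivative_compose[OF bounded_linear_imp_has_derivative[OF bounded_linear_vec_nth]
        assms[unfolded has_field_derivative_def]] .
  then have "frechet_derivative (\<lambda>q. \<phi> (q $ 1)) (at q) = (\<lambda>v. d * v $ 1)"
    using frechet_derivative_at by metis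
  then show ?thesis by (auto simp: gradient_def vec_eq_iff axis_def)
qed

lemma jacobian_coordinate:
  fixes q :: "real^3"
  assumes "(\<phi> has_real_derivative d) (at (q $ 1))"
  shows "jacobian (\<lambda>q. axis 1 (\<phi> (q $ 1)) :: real^3) (at q) = axis 1 (axis 1 d)"
proof -
  have "((\<lambda>q. \<phi> (q $ 1)) has_derivative (\<lambda>v. d * v $ 1)) (at q)"
    using has_derivative_compose[OF bounded_linear_imp_has_derivative[OF bounded_linear_vec_nth]
        assms[unfolded has_field_derivative_def]] .
  then have "((\<lambda>q. \<phi> (q $ 1) *\<^sub>R (axis 1 1 :: real^3)) has_derivative
      (\<lambda>v. (d * v $ 1) *\<^sub>R axis 1 1)) (at q)"
    by (rule has_derivative_scaleR_left)
  moreover have "r *\<^sub>R (axis 1 1 :: real^3) = axis 1 r" for r :: real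
    by (simp add: vec_eq_iff axis_def)
  ultimately have "((\<lambda>q. axis 1 (\<phi> (q $ 1)) :: real^3) has_derivative (\<lambda>v. axis 1 (d * v $ 1))) (at q)"
    by simp
  then have "frechet_derivative (\<lambda>q. axis 1 (\<phi> (q $ 1)) :: real^3) (at q) = (\<lambda>v. axis 1 (d * v $ 1))"
    using frechet_derivative_at by metis
  then show ?thesis by (auto simp: jacobian_def matrix_def vec_eq_iff axis_def)
qed


section \<open>Bounds on the norms\<close>

text \<open>Continuity enters because the essential supremum is infinite for nonmeasurable
  functions.\<close>

lemma linf_norm_le:
  assumes "continuous_on UNIV g" and "\<And>z. z \<in> S \<Longrightarrow> norm (g z) \<le> c"
  shows "linf_norm S g \<le> ennreal c"
  unfolding linf_norm_def
proof (rule esssup_I)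
  have "(\<lambda>z. ennreal (norm (g z))) \<in> borel_measurable borel"
    using borel_measurable_continuous_onI[OF assms(1)] by measurable
  then show "(\<lambda>z. ennreal (norm (g z))) \<in> borel_measurable (lebesgue_on S)"
    by (intro measurable_restrict_space1 measurable_completion) simp
  show "AE z in lebesgue_on S. ennreal (norm (g z)) \<le> ennreal c"
    by (rule AE_I2) (use assms(2) in \<open>auto simp: space_restrict_space intro: ennreal_leI\<close>)
qed

text \<open>The seminorms compare only points at distance \<open>d < 1/2\<close>, where \<open>d \<le> d\<^sup>\<gamma>\<close>; a Lipschitz
  constant therefore bounds them for every exponent \<open>\<gamma> < 1\<close>.\<close>

lemma lipschitz_quotient_le:
  fixes a d L \<gamma> :: real
  assumes "0 < d" "d < 1/2" "\<gamma> < 1" "a \<le> L * d" "0 \<le> L"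
  shows "a / d powr \<gamma> \<le> L"
proof -
  have "d powr 1 \<le> d powr \<gamma>"
    using assms by (intro powr_mono') auto
  then have "L * d \<le> L * d powr \<gamma>"
    using assms by (intro mult_left_mono) auto
  then show ?thesis
    using assms by (simp add: divide_le_eq)
qed

lemma holder_seminorm_p_le:
  assumes "\<gamma> < 1" "0 \<le> L"
    and "\<And>t x p p'. norm (h (t, x, p) - h (t, x, p')) \<le> L * norm (p - p')"
  shows "holder_seminorm_p \<gamma> Q h \<le> ennreal L"
  unfolding holder_seminorm_p_def
  by (rule SUP_least) (use assms in \<open>auto intro!: ennreal_leI lipschitz_quotient_le\<close>)

lemma holder_seminorm_le:
  assumes "\<gamma> < 1" "0 \<le> L" and "\<And>p p'. norm (g p - g p') \<le> L * norm (p - p')"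
  shows "holder_seminorm \<gamma> S g \<le> ennreal L"
  unfolding holder_seminorm_def
  by (rule SUP_least) (use assms in \<open>auto intro!: ennreal_leI lipschitz_quotient_le\<close>)

lemma inverse_jbracket_lipschitz: "\<bar>1 / jbracket p - 1 / jbracket p'\<bar> \<le> norm (p - p')"
proof -
  \<comment> \<open>The bracket is a Euclidean norm, hence Lipschitz by the reverse triangle inequality.\<close>
  have J: "jbracket p = norm (1::real, p)" for p
    by (simp add: jbracket_def norm_Pair)
  have *: "\<bar>jbracket p' - jbracket p\<bar> \<le> norm (p - p')"
    using norm_triangle_ineq3[of "(1::real, p')" "(1, p)"]
    by (simp add: J norm_Pair norm_minus_commute)
  have "1 * 1 \<le> jbracket p * jbracket p'"
    by (intro mult_mono jbracket_ge_1) (auto simp: less_imp_le[OF jbracket_pos])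
  moreover have "1 / jbracket p - 1 / jbracket p' = (jbracket p' - jbracket p) / (jbracket p * jbracket p')"
    using jbracket_pos[of p] jbracket_pos[of p'] by (simp add: field_simps)
  ultimately have "\<bar>1 / jbracket p - 1 / jbracket p'\<bar> \<le> \<bar>jbracket p' - jbracket p\<bar>"
    using mult_left_mono[of 1 "jbracket p * jbracket p'" "\<bar>jbracket p' - jbracket p\<bar>"]
    by (simp add: abs_div divide_le_eq)
  with * show ?thesis by simp
qed

lemma abs_cos_diff_le: "\<bar>cos a - cos b\<bar> \<le> \<bar>a - b\<bar>" for a b :: real
proof -
  have "norm (cos a - cos b) \<le> 1 * norm (a - b)"
    by (rule field_differentiable_bound[where S=UNIV and f'="\<lambda>x. - sin x"])
       (auto intro!: derivative_eq_intros)
  then show ?thesis by simp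
qed

section \<open>The family of counterexamples\<close>

text \<open>The prefactor \<open>1/m\<^sup>2\<close> is the kinetic scaling that keeps \<open>D\<^sub>p\<^sup>2\<close> of order one; the cutoff of the
  moment is \<open>T = m\<close>.\<close>

definition wave :: "real \<Rightarrow> phase \<Rightarrow> real" where
  "wave m = (\<lambda>(t, x, p). 1 / m^2 * osc_moment m 0 (m^3 * x $ 1) (m * p $ 1))"

text \<open>The second cosine is the boundary term of \<open>osc_moment_ode\<close> for \<open>T = m\<close> and \<open>w = m p\<^sub>1\<close>.\<close>

definition wave_forcing :: "real \<Rightarrow> phase \<Rightarrow> real" where
  "wave_forcing m = (\<lambda>(t, x, p). 1 / jbracket p *
     (cos (m^3 * x $ 1) - exp (- (m^3) / 3) * cos (m^3 * x $ 1 - m^2 * p $ 1)))"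

definition diffusion :: "real^3 \<Rightarrow> real^3^3" where
  "diffusion p = (1 / jbracket p) *\<^sub>R mat 1"

lemma bounded_linear_x: "bounded_linear (\<lambda>z::phase. fst (snd z) $ i)"
  and bounded_linear_p: "bounded_linear (\<lambda>z::phase. snd (snd z) $ i)"
  and bounded_linear_p_vec: "bounded_linear (\<lambda>z::phase. snd (snd z))"
  by (auto intro!: bounded_linear_compose[OF bounded_linear_vec_nth] bounded_linear_compose[OF bounded_linear_fst]
      bounded_linear_compose[OF bounded_linear_snd] bounded_linear_snd)

lemma ck_on_wave: "ck_on k (wave m) UNIV"
  unfolding wave_def case_prod_unfold
  by (subst osc_moment_phase)
     (intro ck_on_add ck_on_mult ck_on_const ck_on_osc_moment ck_on_cos ck_on_sin
       ck_on_bounded_linear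
       bounded_linear_x bounded_linear_p)

lemma ck_on_wave_forcing: "ck_on k (wave_forcing m) UNIV"
  unfolding wave_forcing_def case_prod_unfold
  by (intro ck_on_diff ck_on_mult ck_on_const ck_on_inverse_jbracket ck_on_cos ck_on_bounded_linear
       bounded_linear_x bounded_linear_p bounded_linear_p_vec)

lemma ck_on_diffusion: "ck_on k diffusion UNIV"
  unfolding diffusion_def[abs_def]
  by (intro ck_on_scaleR ck_on_const ck_on_inverse_jbracket bounded_linear_ident)

lemma wave_bound:
  assumes "1 \<le> m"
  shows "\<bar>wave m z\<bar> \<le> 1"
proof -
  obtain t x p where z: "z = (t, x, p)" by (cases z)
  have "\<bar>osc_moment m 0 (m^3 * x $ 1) (m * p $ 1)\<bar> \<le> m"
    using assms by (intro osc_moment_bound) simp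
  also have "\<dots> \<le> m^2"
    using assms by (simp add: power2_eq_square)
  finally show ?thesis
    using assms by (simp add: z wave_def abs_mult divide_le_eq)
qed

text \<open>The main oscillation \<open>cos (m\<^sup>3 x\<^sub>1)\<close> does not involve \<open>p\<close>, and the boundary term has momentum
  Lipschitz constant \<open>m\<^sup>2 exp (-m\<^sup>3/3) \<le> 3\<close>. So the forcing is bounded and Lipschitz in \<open>p\<close> uniformly in
  \<open>m\<close>, although it oscillates arbitrarily fast in \<open>x\<close>.\<close>

lemma wave_forcing_bound:
  assumes "1 \<le> m"
  shows "\<bar>wave_forcing m z\<bar> \<le> 2"
    and "\<bar>wave_forcing m (t, x, p) - wave_forcing m (t, x, p')\<bar> \<le> 5 * norm (p - p')"
proof -
  define E where "E = exp (- (m^3) / 3)"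
  define u where "u x p = cos (m^3 * x $ 1) - E * cos (m^3 * x $ 1 - m^2 * p $ 1)" for x p :: "real^3"
  have J: "\<bar>1 / jbracket p\<bar> \<le> 1" for p
    using jbracket_ge_1[of p] by simp
  have E: "0 \<le> E" "E \<le> 1"
    using assms by (auto simp: E_def)
  have Em: "E * m^2 \<le> 3"
  proof -
    have "m^2 \<le> m^3" using assms by (intro power_increasing) auto
    also have "\<dots> \<le> 3 * exp (m^3 / 3)"
      using exp_ge_add_one_self[of "m^3 / 3"] by linarith
    finally show ?thesis
      by (simp add: E_def exp_minus field_simps)
  qed
  have u2: "\<bar>u x p\<bar> \<le> 2" for x p
  proof -
    have "\<bar>E * cos (m^3 * x $ 1 - m^2 * p $ 1)\<bar> \<le> 1 * 1"
      unfolding abs_mult using E by (intro mult_mono) auto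
    moreover have "\<bar>cos (m^3 * x $ 1)\<bar> \<le> 1" by simp
    ultimately show ?thesis unfolding u_def by linarith
  qed
  have u3: "\<bar>u x p - u x p'\<bar> \<le> 3 * norm (p - p')" for p p'
  proof -
    have "\<bar>u x p - u x p'\<bar> = E * \<bar>cos (m^3 * x $ 1 - m^2 * p' $ 1) - cos (m^3 * x $ 1 - m^2 * p $ 1)\<bar>"
      using E by (simp add: u_def right_diff_distrib[symmetric] abs_mult)
    also have "\<dots> \<le> E * \<bar>m^2 * (p - p') $ 1\<bar>"
      using E by (intro mult_left_mono order_trans[OF abs_cos_diff_le]) (auto simp: algebra_simps)
    also have "\<dots> = (E * m^2) * \<bar>(p - p') $ 1\<bar>"
      by (simp add: abs_mult)
    also have "\<dots> \<le> 3 * norm (p - p')"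
      by (intro mult_mono Em component_le_norm_cart) auto
    finally show ?thesis .
  qed
  have w: "wave_forcing m (t, x, p) = 1 / jbracket p * u x p" for t x p
    by (simp add: wave_forcing_def u_def E_def)
  obtain t' x' q where z: "z = (t', x', q)" by (cases z)
  have "\<bar>wave_forcing m z\<bar> \<le> 1 * 2"
    unfolding z w abs_mult by (intro mult_mono J u2) auto
  then show "\<bar>wave_forcing m z\<bar> \<le> 2" by simp
  have "wave_forcing m (t, x, p) - wave_forcing m (t, x, p')
      = (1 / jbracket p - 1 / jbracket p') * u x p + 1 / jbracket p' * (u x p - u x p')"
    unfolding w by (simp add: algebra_simps)
  also have "\<bar>\<dots>\<bar> \<le> norm (p - p') * 2 + 1 * (3 * norm (p - p'))"
    by (rule order_trans[OF abs_triangle_ineq], unfold abs_mult)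
       (intro add_mono mult_mono inverse_jbracket_lipschitz u2 J u3; simp)
  finally show "\<bar>wave_forcing m (t, x, p) - wave_forcing m (t, x, p')\<bar> \<le> 5 * norm (p - p')"
    by simp
qed

lemma holder_norm_p_wave_forcing:
  assumes "1 \<le> m" "\<beta> < 1"
  shows "holder_norm_p \<beta> Q (wave_forcing m) \<le> ennreal 7"
proof -
  have "holder_norm_p \<beta> Q (wave_forcing m) \<le> ennreal 2 + ennreal 5"
    unfolding holder_norm_p_def
    using wave_forcing_bound[OF assms(1)] ck_on_wave_forcing[of 0 m] assms(2)
    by (intro add_mono linf_norm_le holder_seminorm_p_le) auto
  then show ?thesis by (simp flip: ennreal_plus)
qed

lemma holder_norm_diffusion_finite:
  assumes "\<beta> < 1"
  shows "holder_norm \<beta> S diffusion < \<infinity>"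
proof -
  let ?N = "norm (mat 1 :: real^3^3)"
  have "norm (diffusion p) \<le> 1 * ?N" for p
    unfolding diffusion_def norm_scaleR using jbracket_ge_1[of p]
    by (intro mult_right_mono) auto
  moreover have "norm (diffusion p - diffusion p') \<le> ?N * norm (p - p')" for p p'
    unfolding diffusion_def scaleR_left_diff_distrib[symmetric] norm_scaleR
    using inverse_jbracket_lipschitz[of p p'] by (simp add: mult.commute mult_left_mono)
  ultimately have "holder_norm \<beta> S diffusion \<le> ennreal (1 * ?N) + ennreal ?N"
    unfolding holder_norm_def using ck_on_diffusion[of 0] assms
    by (intro add_mono linf_norm_le holder_seminorm_le) auto
  also have "\<dots> < \<infinity>" by (simp flip: ennreal_plus)
  finally show ?thesis .
qed

lemma holder_norm_zero_finite:
  assumes "\<beta> < 1"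
  shows "holder_norm \<beta> S (\<lambda>p. 0 :: real^3) < \<infinity>"
proof -
  have "holder_norm \<beta> S (\<lambda>p. 0 :: real^3) \<le> ennreal 0 + ennreal 0"
    unfolding holder_norm_def using assms
    by (intro add_mono linf_norm_le holder_seminorm_le) auto
  then show ?thesis by (auto simp: less_top[symmetric])
qed

lemma diffusion_elliptic: "elliptic_on (1/2) 1 (ball 0 1) diffusion"
  unfolding elliptic_on_def
proof (intro ballI allI)
  fix p \<xi> :: "real^3" assume "p \<in> ball 0 1"
  then have "norm p < 1" by simp
  then have "(norm p)^2 \<le> 1" by (simp add: power_le_one)
  then have "jbracket p \<le> 2"
    unfolding jbracket_def by (intro real_le_lsqrt) auto
  then have "1/2 \<le> 1 / jbracket p"
    using jbracket_pos[of p] by (simp add: field_simps)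
  moreover have "1 / jbracket p \<le> 1"
    using jbracket_ge_1[of p] by simp
  moreover have "\<xi> \<bullet> (diffusion p *v \<xi>) = 1 / jbracket p * (\<xi> \<bullet> \<xi>)"
    by (simp add: diffusion_def scaleR_matrix_vector_assoc[symmetric])
  ultimately show "1/2 * (\<xi> \<bullet> \<xi>) \<le> \<xi> \<bullet> (diffusion p *v \<xi>) \<and> \<xi> \<bullet> (diffusion p *v \<xi>) \<le> 1 * (\<xi> \<bullet> \<xi>)"
    by (simp only:) (intro conjI mult_right_mono inner_ge_zero)
qed

lemma grad_x_wave:
  assumes "0 < m"
  shows "grad_x (wave m) (t, x, p) = axis 1 (osc_moment m 0 (m^3 * x $ 1 + pi/2) (m * p $ 1) * m)"
proof -
  have "((\<lambda>r. 1 / m^2 * osc_moment m 0 (m^3 * r) (m * p $ 1)) has_real_derivative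
      1 / m^2 * (osc_moment m 0 (m^3 * x $ 1 + pi/2) (m * p $ 1) * m^3)) (at (x $ 1))"
    by (intro DERIV_cmult DERIV_chain2[OF osc_moment_DERIV_phase]) (auto intro!: derivative_eq_intros)
  from gradient_coordinate[OF this] show ?thesis
    using assms by (simp add: grad_x_def wave_def power2_eq_square power3_eq_cube)
qed

lemma hess_p_wave:
  assumes "0 < m"
  shows "hess_p (wave m) (t, x, p) = axis 1 (axis 1 (osc_moment m 2 (m^3 * x $ 1 - pi) (m * p $ 1)))"
proof -
  have 1: "((\<lambda>r. 1 / m^2 * osc_moment m 0 (m^3 * x $ 1) (m * r)) has_real_derivative
      1 / m^2 * (osc_moment m 1 (m^3 * x $ 1 - pi/2) (m * r) * m)) (at r)" for r
    unfolding One_nat_def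
    by (intro DERIV_cmult DERIV_chain2[OF osc_moment_DERIV]) (auto intro!: derivative_eq_intros)
  have grad: "gradient (\<lambda>q. wave m (t, x, q)) =
      (\<lambda>q. axis 1 (1 / m^2 * (osc_moment m 1 (m^3 * x $ 1 - pi/2) (m * q $ 1) * m)))"
    using gradient_coordinate[OF 1] by (simp add: fun_eq_iff wave_def)
  have "((\<lambda>r. 1 / m^2 * (osc_moment m 1 (m^3 * x $ 1 - pi/2) (m * r) * m)) has_real_derivative
      1 / m^2 * (osc_moment m (Suc 1) (m^3 * x $ 1 - pi/2 - pi/2) (m * p $ 1) * m * m)) (at (p $ 1))"
    by (intro DERIV_cmult DERIV_cmult_right DERIV_chain2[OF osc_moment_DERIV])
       (auto intro!: derivative_eq_intros)
  from jacobian_coordinate[OF this] show ?thesis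
    using assms by (simp add: hess_p_def grad power2_eq_square numeral_2_eq_2)
qed

lemma trace_diffusion_axis:
  "trace (diffusion p ** axis 1 (axis 1 d)) = d / jbracket p"
  by (simp add: trace_def matrix_matrix_mult_def diffusion_def mat_def axis_def sum_3)

text \<open>The factor \<open>1 / \<langle>p\<rangle>\<close> of the velocity is common to transport, diffusion and forcing; removing it
  leaves \<open>osc_moment_ode\<close> at \<open>\<theta> = m\<^sup>3 x\<^sub>1\<close>, \<open>w = m p\<^sub>1\<close>.\<close>

lemma wave_smooth_solution:
  assumes "0 < m"
  shows "smooth_solution Q diffusion (\<lambda>p. 0) (wave_forcing m) (wave m)"
  unfolding smooth_solution_def
proof (intro conjI)
  show "smooth_on diffusion UNIV" "smooth_on (\<lambda>p. 0 :: real^3) UNIV" "smooth_on (wave_forcing m) UNIV"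
    "smooth_on (wave m) Q"
    by (intro smooth_onI ck_on_diffusion ck_on_const ck_on_wave_forcing ck_on_wave)+
  show "\<forall>p. transpose (diffusion p) = diffusion p"
    by (simp add: diffusion_def transpose_def mat_def vec_eq_iff)
  have "dt (wave m) (t, x, p) + ((1 / jbracket p) *\<^sub>R p) \<bullet> grad_x (wave m) (t, x, p)
      = trace (diffusion p ** hess_p (wave m) (t, x, p)) + 0 \<bullet> grad_p (wave m) (t, x, p)
        + wave_forcing m (t, x, p)" for t x p
  proof -
    have "dt (wave m) (t, x, p) = 0"
      by (simp add: dt_def wave_def)
    moreover have "m * p $ 1 * osc_moment m 0 (m^3 * x $ 1 + pi/2) (m * p $ 1)
        = osc_moment m 2 (m^3 * x $ 1 - pi) (m * p $ 1)
          + (cos (m^3 * x $ 1) - exp (- (m^3) / 3) * cos (m^3 * x $ 1 - m^2 * p $ 1))"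
      using osc_moment_ode[of m "m * p $ 1" "m^3 * x $ 1"] assms
      by (simp add: power2_eq_square mult_ac)
    ultimately show ?thesis
      using jbracket_pos[of p] assms
      by (simp add: grad_x_wave hess_p_wave trace_diffusion_axis inner_axis wave_forcing_def
          add_divide_distrib[symmetric] mult_ac)
  qed
  then show "\<forall>(t, x, p)\<in>Q. dt (wave m) (t, x, p) + ((1 / jbracket p) *\<^sub>R p) \<bullet> grad_x (wave m) (t, x, p)
      = trace (diffusion p ** hess_p (wave m) (t, x, p)) + 0 \<bullet> grad_p (wave m) (t, x, p)
        + wave_forcing m (t, x, p)"
    by blast
qed

text \<open>Compare \<open>p = 0\<close> with \<open>p = (\<pi>/m) e\<^sub>1\<close> at \<open>t = 0\<close>, \<open>x = 0\<close>: these are the values \<open>w = 0\<close> and \<open>w = \<pi>\<close> of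
  \<open>osc_moment_gap\<close>. The condition \<open>m \<ge> 7 > 2 \<pi>\<close> places both points in the small cylinder and at
  distance below \<open>1/2\<close>.\<close>

lemma hess_p_wave_holder_lower_bound:
  assumes "7 \<le> m"
  shows "ennreal (1/12 * (m / pi) powr \<alpha>) \<le> holder_seminorm_p \<alpha> (cyl (1/2)) (hess_p (wave m))"
proof -
  define p :: "real^3" where "p = (pi / m) *\<^sub>R axis 1 1"
  have m: "0 < m" using assms by simp
  have np: "norm p = pi / m"
    using m by (simp add: p_def)
  have p0: "p \<noteq> 0"
    using np m by auto
  have small: "pi / m < 1/2"
    using m assms pi_approx by (simp add: field_simps)
  define D where "D = osc_moment m 2 (- pi) pi - osc_moment m 2 (- pi) 0"
  have D: "1/12 \<le> D" unfolding D_def using assms by (intro osc_moment_gap) simp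
  have "(hess_p (wave m) (0, 0, p) - hess_p (wave m) (0, 0, 0)) $ 1 $ 1 = D"
    using m by (simp add: hess_p_wave D_def p_def)
  then have "D \<le> norm (hess_p (wave m) (0, 0, p) - hess_p (wave m) (0, 0, 0))"
    using component_le_norm_cart[of "(hess_p (wave m) (0, 0, p) - hess_p (wave m) (0, 0, 0)) $ 1" 1]
      Finite_Cartesian_Product.norm_nth_le[of "hess_p (wave m) (0, 0, p) - hess_p (wave m) (0, 0, 0)" 1]
    by linarith
  with D have "1/12 \<le> norm (hess_p (wave m) (0, 0, p) - hess_p (wave m) (0, 0, 0))" by simp
  then have "1/12 / (pi / m) powr \<alpha>
      \<le> norm (hess_p (wave m) (0, 0, p) - hess_p (wave m) (0, 0, 0)) / norm (p - 0) powr \<alpha>"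
    unfolding diff_zero np by (intro divide_right_mono) auto
  moreover have "1/12 / (pi / m) powr \<alpha> = 1/12 * (m / pi) powr \<alpha>"
    using m by (simp add: powr_divide field_simps)
  ultimately have "ennreal (1/12 * (m / pi) powr \<alpha>)
      \<le> ennreal (norm (hess_p (wave m) (0, 0, p) - hess_p (wave m) (0, 0, 0)) / norm (p - 0) powr \<alpha>)"
    by (intro ennreal_leI) (simp only:)
  also have "\<dots> \<le> holder_seminorm_p \<alpha> (cyl (1/2)) (hess_p (wave m))"
    unfolding holder_seminorm_p_def
    by (rule SUP_upper2[where i="(0, 0, p, 0)"]) (use small p0 in \<open>auto simp: cyl_def np\<close>)
  finally show ?thesis .
qed

theorem corollary3p4:
  fixes \<alpha> \<beta> :: real
  assumes "0 < \<alpha>" "\<alpha> < 1" "0 < \<beta>" "\<beta> < 1"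
  shows "\<exists>lam Lam :: real. 0 < lam \<and> lam \<le> Lam \<and>
    \<not> (\<exists>F. bounding_function F \<and>
          (\<forall>A B s f.
             smooth_solution (cyl 1) A B s f \<and>
             elliptic_on lam Lam (ball 0 1) A \<and>
             linf_norm (cyl 1) f < \<infinity> \<and>
             holder_norm_p \<beta> (cyl 1) s < \<infinity> \<and>
             holder_norm \<beta> (ball 0 1) A < \<infinity> \<and>
             holder_norm \<beta> (ball 0 1) B < \<infinity> \<longrightarrow>
             holder_seminorm_p \<alpha> (cyl (1/2)) (hess_p f)
               \<le> ennreal (F (enn2real (linf_norm (cyl 1) f),
                             enn2real (holder_norm_p \<beta> (cyl 1) s),
                             enn2real (holder_norm \<beta> (ball 0 1) A),
                             enn2real (holder_norm \<beta> (ball 0 1) B)))))"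
proof (intro exI conjI notI)
  show "(0::real) < 1/2" "(1/2::real) \<le> 1" by auto
  assume "\<exists>F. bounding_function F \<and>
          (\<forall>A B s f.
             smooth_solution (cyl 1) A B s f \<and>
             elliptic_on (1/2) 1 (ball 0 1) A \<and>
             linf_norm (cyl 1) f < \<infinity> \<and>
             holder_norm_p \<beta> (cyl 1) s < \<infinity> \<and>
             holder_norm \<beta> (ball 0 1) A < \<infinity> \<and>
             holder_norm \<beta> (ball 0 1) B < \<infinity> \<longrightarrow>
             holder_seminorm_p \<alpha> (cyl (1/2)) (hess_p f)
               \<le> ennreal (F (enn2real (linf_norm (cyl 1) f),
                             enn2real (holder_norm_p \<beta> (cyl 1) s),
                             enn2real (holder_norm \<beta> (ball 0 1) A),
                             enn2real (holder_norm \<beta> (ball 0 1) B))))"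
  then obtain F where F: "bounding_function F" and
    estimate: "\<And>A B s f. smooth_solution (cyl 1) A B s f \<Longrightarrow> elliptic_on (1/2) 1 (ball 0 1) A \<Longrightarrow>
      linf_norm (cyl 1) f < \<infinity> \<Longrightarrow> holder_norm_p \<beta> (cyl 1) s < \<infinity> \<Longrightarrow>
      holder_norm \<beta> (ball 0 1) A < \<infinity> \<Longrightarrow> holder_norm \<beta> (ball 0 1) B < \<infinity> \<Longrightarrow>
      holder_seminorm_p \<alpha> (cyl (1/2)) (hess_p f)
        \<le> ennreal (F (enn2real (linf_norm (cyl 1) f), enn2real (holder_norm_p \<beta> (cyl 1) s),
            enn2real (holder_norm \<beta> (ball 0 1) A), enn2real (holder_norm \<beta> (ball 0 1) B)))"
    by blast
  \<comment> \<open>The coefficients do not depend on \<open>m\<close>, so their norms are two fixed numbers, and the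
      arguments of \<open>F\<close> range over a bounded set \<open>S\<close>.\<close>
  define a where "a = enn2real (holder_norm \<beta> (ball 0 1) diffusion)"
  define b where "b = enn2real (holder_norm \<beta> (ball 0 1) (\<lambda>p. 0 :: real^3))"
  define S where "S = {0..1::real} \<times> {0..7::real} \<times> {a} \<times> {b}"
  have "S \<subseteq> nonneg_quadruples"
    by (auto simp: S_def nonneg_quadruples_def a_def b_def)
  moreover have "bounded S"
    unfolding S_def by (intro bounded_Times) auto
  ultimately have "bounded (F ` S)"
    using F by (simp add: bounding_function_def)
  then obtain M where M: "\<And>q. q \<in> S \<Longrightarrow> \<bar>F q\<bar> \<le> M"
    by (auto simp: bounded_iff)
  have bound: "1/12 * (m / pi) powr \<alpha> \<le> M" if m: "7 \<le> m" for m
  proof -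
    have f: "linf_norm (cyl 1) (wave m) \<le> ennreal 1"
      using wave_bound[of m] ck_on_wave[of 0 m] m by (intro linf_norm_le) auto
    have s: "holder_norm_p \<beta> (cyl 1) (wave_forcing m) \<le> ennreal 7"
      using m assms by (intro holder_norm_p_wave_forcing) auto
    let ?q = "(enn2real (linf_norm (cyl 1) (wave m)),
      enn2real (holder_norm_p \<beta> (cyl 1) (wave_forcing m)), a, b)"
    have "enn2real (linf_norm (cyl 1) (wave m)) \<le> 1"
      "enn2real (holder_norm_p \<beta> (cyl 1) (wave_forcing m)) \<le> 7"
      using f s by (auto intro: enn2real_leI)
    then have q: "?q \<in> S"
      by (auto simp: S_def)
    have "ennreal (1/12 * (m / pi) powr \<alpha>) \<le> holder_seminorm_p \<alpha> (cyl (1/2)) (hess_p (wave m))"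
      by (rule hess_p_wave_holder_lower_bound[OF m])
    also have "\<dots> \<le> ennreal (F ?q)"
      unfolding a_def b_def
      using m f s assms order.strict_trans1[OF f] order.strict_trans1[OF s]
      by (intro estimate wave_smooth_solution diffusion_elliptic holder_norm_diffusion_finite
          holder_norm_zero_finite) auto
    also have "\<dots> \<le> ennreal M"
      using M[OF q] by (intro ennreal_leI) simp
    finally show ?thesis
      using M[OF q] by (subst (asm) ennreal_le_iff) auto
  qed
  \<comment> \<open>Since \<open>\<alpha> > 0\<close>, some \<open>m\<close> makes \<open>(m / \<pi>)\<^sup>\<alpha>\<close> exceed \<open>12 M\<close>.\<close>
  define m where "m = max 7 (pi * (12 * \<bar>M\<bar> + 12) powr (1/\<alpha>))"
  have "(12 * \<bar>M\<bar> + 12) powr (1/\<alpha>) \<le> m / pi"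
    by (simp add: m_def field_simps)
  then have "((12 * \<bar>M\<bar> + 12) powr (1/\<alpha>)) powr \<alpha> \<le> (m / pi) powr \<alpha>"
    using assms by (intro powr_mono2) auto
  then have "12 * \<bar>M\<bar> + 12 \<le> (m / pi) powr \<alpha>"
    using assms by (simp add: powr_powr)
  with bound[of m] show False
    by (simp add: m_def)
qed

end
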